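(* Let $A\in\mathbb{R}^{n\times n}\setminus\{0\}$ be symmetric positive semidefinite, let $M\in\mathbb{R}^{n\times n}$ satisfy $\|I-MA\|_A\le 1$, and let $P\in\mathbb{R}^{n\times n_{\rm c}}$ with $n_{\rm c}<n$ be such that $A_{\rm c}:=P^{T}AP$ is nonzero. Put $\overline{M}:=M+M^{T}-M^{T}AM$ and assume $$\mathcal{N}\big(A^{\frac12}\overline{M}A^{\frac12}\big)\cap\mathcal{N}\big(P^{T}(I-AM)A^{\frac12}\big)=\mathcal{N}(A).$$ Let $r=\operatorname{rank}(A)$ and $s=\operatorname{rank}(A_{\rm c})$, and assume $s<r$. Define $$\widetilde{M}:=M+M^{T}-MAM^{T},\qquad \Pi_{A}:=PA_{\rm c}^{\dagger}P^{T}A,\qquad E_{\rm TG}:=\big(I-PA_{\rm c}^{\dagger}P^{T}A\big)(I-MA).$$ Then $$\|E_{\rm TG}\|_{A}=\sqrt{1-\lambda_{n-r+s+1}\big(\widetilde{M}A(I-\Pi_{A})\big)}.$$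
   Context: $\mathcal{N}(\cdot)$ denotes the null space, $(\cdot)^{\dagger}$ the Moore--Penrose inverse, and $A^{\frac12}$ the symmetric positive semidefinite square root of $A$. For a matrix with real eigenvalues, $\lambda_i(\cdot)$ denotes its $i$th smallest eigenvalue (counted with algebraic multiplicity). For $\mathbf{v}\in\mathbb{R}^n$, $\|\mathbf{v}\|_A:=\sqrt{\mathbf{v}^{T}A\mathbf{v}}$, and for $X\in\mathbb{R}^{n\times n}$, $$\|X\|_A:=\sup_{\mathbf{v}\in\mathbb{R}^n\setminus\mathcal{N}(A)}\frac{\|X\mathbf{v}\|_A}{\|\mathbf{v}\|_A}\in[0,+\infty].$$ $E_{\rm TG}$ is the error propagation matrix of the exact two-grid method with smoother $M$, prolongation $P$ and coarse solver $A_{\rm c}^{\dagger}$; $\|E_{\rm TG}\|_A$ is its convergence factor. The eigenvalues of $\widetilde{M}A(I-\Pi_A)$ are real. *)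

theory Defs
  imports
    "HOL-Analysis.Analysis"
    "HOL-Computational_Algebra.Polynomial"
begin

text \<open>
  A matrix with \<open>m\<close> rows and \<open>n\<close> columns has type \<^typ>\<open>real^'n^'m\<close> (the column index comes
  first); the dimensions are \<^term>\<open>CARD('m)\<close> and \<^term>\<open>CARD('n)\<close>.
\<close>

definition null_space :: "real^'n^'m \<Rightarrow> (real^'n) set" where
  "null_space A = {v. A *v v = 0}"

definition sym_psd :: "real^'n^'n \<Rightarrow> bool" where
  "sym_psd A \<longleftrightarrow> transpose A = A \<and> (\<forall>v. 0 \<le> v \<bullet> (A *v v))"

text \<open>
  The following two definitions by \<open>THE\<close> are meaningful because the object described exists
  and is unique: for every symmetric positive semidefinite matrix in the case of the square
  root, and for every real matrix in the case of the Moore--Penrose inverse, which is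
  characterised by the four Penrose equations.
\<close>

definition psd_sqrt :: "real^'n^'n \<Rightarrow> real^'n^'n" where
  "psd_sqrt A = (THE B. sym_psd B \<and> B ** B = A)"

definition is_pinv :: "real^'n^'m \<Rightarrow> real^'m^'n \<Rightarrow> bool" where
  "is_pinv A X \<longleftrightarrow>
     A ** X ** A = A \<and> X ** A ** X = X \<and>
     transpose (A ** X) = A ** X \<and> transpose (X ** A) = X ** A"

definition pinv :: "real^'n^'m \<Rightarrow> real^'m^'n" where
  "pinv A = (THE X. is_pinv A X)"

definition char_poly :: "real^'n^'n \<Rightarrow> real poly" where
  "char_poly B = det (\<chi> i j. (if i = j then [:0, 1:] else 0) - [:B $ i $ j:])"

text \<open>
  The \<open>i\<close>-th smallest eigenvalue, counted from \<open>i = 1\<close> and with algebraic multiplicity. Only real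
  roots of the characteristic polynomial are listed, so this is to be used for matrices all of
  whose eigenvalues are real and for \<open>1 \<le> i \<le> CARD('n)\<close>.
\<close>

definition nth_smallest_eigenvalue :: "nat \<Rightarrow> real^'n^'n \<Rightarrow> real" where
  "nth_smallest_eigenvalue i B = sorted_list_of_multiset (proots (char_poly B)) ! (i - 1)"

definition norm_wrt :: "real^'n^'n \<Rightarrow> real^'n \<Rightarrow> real" where
  "norm_wrt A v = sqrt (v \<bullet> (A *v v))"

text \<open>
  The supremum may be infinite, hence \<^typ>\<open>ereal\<close>. For symmetric positive semidefinite \<open>A \<noteq> 0\<close>
  the index set is nonempty and no denominator vanishes.
\<close>

definition mnorm_wrt :: "real^'n^'n \<Rightarrow> real^'n^'n \<Rightarrow> ereal" where
  "mnorm_wrt A X = (SUP v \<in> - null_space A. ereal (norm_wrt A (X *v v) / norm_wrt A v))"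

definition M_bar :: "real^'n^'n \<Rightarrow> real^'n^'n \<Rightarrow> real^'n^'n" where
  "M_bar A M = M + transpose M - transpose M ** A ** M"

definition M_tilde :: "real^'n^'n \<Rightarrow> real^'n^'n \<Rightarrow> real^'n^'n" where
  "M_tilde A M = M + transpose M - M ** A ** transpose M"

definition coarse_matrix :: "real^'n^'n \<Rightarrow> real^'c^'n \<Rightarrow> real^'c^'c" where
  "coarse_matrix A P = transpose P ** A ** P"

definition Pi_A :: "real^'n^'n \<Rightarrow> real^'c^'n \<Rightarrow> real^'n^'n" where
  "Pi_A A P = P ** pinv (coarse_matrix A P) ** transpose P ** A"

definition E_TG :: "real^'n^'n \<Rightarrow> real^'n^'n \<Rightarrow> real^'c^'n \<Rightarrow> real^'n^'n" where
  "E_TG A M P =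
     (mat 1 - P ** pinv (coarse_matrix A P) ** transpose P ** A) ** (mat 1 - M ** A)"

end

theory Submission
  imports Defs
begin

text \<open>
  Let \<open>S\<close> be a symmetric matrix with \<open>S ** S = A\<close>. The map \<open>v \<mapsto> S *v v\<close> turns the energy
  seminorm of \<open>A\<close> into the Euclidean norm on \<open>R = range S\<close>. It turns the smoother into
  \<open>X = I - S M S\<close>, which is a contraction of \<open>R\<close>, and the coarse correction into \<open>I - Q\<close>, where
  \<open>Q\<close> is the orthogonal projector onto the range of \<open>S ** P\<close> (\<open>gram_pinv_projector\<close>). The number
  to compute is therefore the operator norm of \<open>(I - Q) X\<close> on \<open>R\<close>. Its values lie in the space
  \<open>W\<close> of vectors in \<open>R\<close> orthogonal to the range of \<open>S ** P\<close>, and \<open>dim W = r - s\<close> by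
  \<open>rank_gram\<close>.

  An operator and its adjoint have the same norm, and the adjoint acts on \<open>W\<close> as
  \<open>transpose X\<close>. Since \<open>X (transpose X) = I - T\<close> with \<open>T = S (M_tilde A M) S\<close>, the squared
  norm of \<open>transpose X\<close> on \<open>W\<close> is \<open>1 - \<mu>\<close>, where \<open>\<mu>\<close> is the minimum of the Rayleigh quotient
  of \<open>T\<close> over \<open>W\<close>. Contractivity of \<open>X\<close> gives \<open>\<mu> \<ge> 0\<close>.

  It remains to recognize \<open>\<mu>\<close> as an eigenvalue. Because \<open>A B\<close> and \<open>B A\<close> have the same
  characteristic polynomial (\<open>char_poly_mult_commute\<close>), the matrix
  \<open>M_tilde A M ** A ** (mat 1 - Pi_A A P)\<close> has the eigenvalues of the symmetric matrix
  \<open>K = (I - Q) T (I - Q)\<close>. On the orthogonal complement of \<open>W\<close>, of dimension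
  \<open>n - r + s\<close>, \<open>K\<close> is zero, and on \<open>W\<close> its eigenvalues are nonnegative with minimum \<open>\<mu>\<close>. Hence
  \<open>\<mu>\<close> is the entry number \<open>n - r + s + 1\<close> of the sorted list
  (\<open>nth_smallest_eigenvalue_compression\<close>).

  Existence of \<open>S\<close>, of the pseudoinverse of the coarse matrix and of eigenbases all rest on the
  spectral theorem for symmetric matrices
  (\<open>orthonormal_eigenbasis_of_invariant_subspace\<close>).
\<close>

section \<open>Matrix algebra\<close>

lemma inner_matrix_vector_mult:
  fixes A :: "real^'n^'m"
  shows "(A *v x) \<bullet> y = x \<bullet> (transpose A *v y)"
  by (metis dot_lmul_matrix inner_commute transpose_matrix_vector)

lemma matrix_vector_mult_mat1_minus:
  fixes A :: "real^'n^'n"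
  shows "(mat 1 - A) *v x = x - A *v x"
  by (simp add: matrix_vector_mult_diff_rdistrib)

lemma transpose_add: "transpose (A + B) = transpose A + transpose B"
  by (simp add: transpose_def vec_eq_iff)

lemma transpose_diff: "transpose (A - B) = transpose A - transpose B"
  by (simp add: transpose_def vec_eq_iff)

section \<open>Characteristic polynomials of products\<close>

lemma poly_char_poly:
  fixes B :: "real^'n^'n"
  shows "poly (char_poly B) t = det (t *\<^sub>R mat 1 - B)"
  unfolding char_poly_def det_def
  by (auto simp: poly_sum poly_prod mat_def intro!: sum.cong prod.cong)

text \<open>
  A value of \<open>t\<close> beyond a bound \<open>c\<close> for the operator norm of \<open>B\<close> is not an eigenvalue, so
  \<open>t = c + 1\<close> is not a root.
\<close>

lemma char_poly_nonzero:
  fixes B :: "real^'n^'n"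
  shows "char_poly B \<noteq> 0"
proof -
  obtain c where c: "\<And>x. norm (B *v x) \<le> norm x * c"
    using bounded_linear.nonneg_bounded[OF matrix_vector_mul_bounded_linear[of B]] by auto
  have "x = 0" if "((c + 1) *\<^sub>R mat 1 - B) *v x = 0" for x
  proof -
    have "B *v x = (c + 1) *\<^sub>R x"
      using that by (simp add: matrix_vector_mult_diff_rdistrib scaleR_matrix_vector_assoc[symmetric])
    then have "\<bar>c + 1\<bar> * norm x \<le> norm x * c"
      using c[of x] by simp
    then have "norm x \<le> 0"
      by (smt (verit, best) mult.commute mult_left_mono norm_ge_zero mult_cancel_left1 distrib_left)
    then show ?thesis by simp
  qed
  then have "det ((c + 1) *\<^sub>R mat 1 - B) \<noteq> 0"
    by (metis invertible_det_nz invertible_left_inverse matrix_left_invertible_ker)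
  then show ?thesis
    by (metis poly_0 poly_char_poly)
qed

lemma det_shift_mult_commute_invertible:
  fixes A B :: "real^'n^'n"
  assumes "det A \<noteq> 0"
  shows "det (t *\<^sub>R mat 1 - A ** B) = det (t *\<^sub>R mat 1 - B ** A)"
proof -
  have "(t *\<^sub>R mat 1 - A ** B) ** A = A ** (t *\<^sub>R mat 1 - B ** A)"
    by (simp add: matrix_eq matrix_vector_mul_assoc[symmetric] matrix_vector_mult_diff_rdistrib
        matrix_vector_mult_diff_distrib scaleR_matrix_vector_assoc[symmetric] matrix_vector_mult_scaleR)
  then have "det (t *\<^sub>R mat 1 - A ** B) * det A = det A * det (t *\<^sub>R mat 1 - B ** A)"
    by (metis det_mul)
  with assms show ?thesis by simp
qed

text \<open>
  For invertible \<open>A\<close> the two products are similar. In general \<open>A\<close> is perturbed to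
  \<open>A + e I\<close>, which is singular for only finitely many \<open>e\<close>; both determinants are continuous
  in \<open>e\<close>, so they still agree at \<open>e = 0\<close>.
\<close>

lemma char_poly_mult_commute:
  fixes A B :: "real^'n^'n"
  shows "char_poly (A ** B) = char_poly (B ** A)"
proof -
  have "det (t *\<^sub>R mat 1 - A ** B) = det (t *\<^sub>R mat 1 - B ** A)" for t
  proof -
    define f where "f e = det (t *\<^sub>R mat 1 - (A + e *\<^sub>R mat 1) ** B)" for e
    define g where "g e = det (t *\<^sub>R mat 1 - B ** (A + e *\<^sub>R mat 1))" for e
    have cont_det: "isCont (\<lambda>e. det (X + e *\<^sub>R Y)) 0" for X Y :: "real^'n^'n"
      unfolding det_def by (intro continuous_intros)
    \<comment> \<open>Both perturbed matrices are affine in \<open>e\<close>, which makes their determinants continuous.\<close>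
    have "f = (\<lambda>e. det ((t *\<^sub>R mat 1 - A ** B) + e *\<^sub>R (- B)))"
      by (auto simp: f_def fun_eq_iff intro!: arg_cong[where f=det]
          simp: matrix_eq matrix_vector_mul_assoc[symmetric] algebra_simps scaleR_matrix_vector_assoc[symmetric])
    then have f: "f \<midarrow>0\<rightarrow> f 0"
      using cont_det by (metis isCont_def)
    have "g = (\<lambda>e. det ((t *\<^sub>R mat 1 - B ** A) + e *\<^sub>R (- B)))"
      by (auto simp: g_def fun_eq_iff intro!: arg_cong[where f=det]
          simp: matrix_eq matrix_vector_mul_assoc[symmetric] algebra_simps scaleR_matrix_vector_assoc[symmetric] matrix_vector_mult_scaleR)
    then have g: "g \<midarrow>0\<rightarrow> g 0"
      using cont_det by (metis isCont_def)
    let ?Z = "{e. poly (char_poly (- A)) e = 0}"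
    have "finite ?Z"
      by (rule poly_roots_finite) (rule char_poly_nonzero)
    then have "open (- (?Z - {0}))"
      by (intro open_Compl finite_imp_closed finite_Diff)
    then have "\<forall>\<^sub>F e in at 0. e \<notin> ?Z"
      unfolding eventually_at_topological by blast
    then have "\<forall>\<^sub>F e in at 0. f e = g e"
    proof eventually_elim
      case (elim e)
      then have "det (A + e *\<^sub>R mat 1) \<noteq> 0"
        by (simp add: poly_char_poly add.commute)
      then show ?case
        by (simp add: f_def g_def det_shift_mult_commute_invertible)
    qed
    then have "g \<midarrow>0\<rightarrow> f 0"
      using f tendsto_cong by blast
    then have "f 0 = g 0"
      using g LIM_unique by blast
    then show ?thesis by (simp add: f_def g_def)
  qed
  then show ?thesis
    by (simp add: poly_eq_poly_eq_iff[symmetric] fun_eq_iff poly_char_poly)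
qed

section \<open>Diagonal matrices\<close>

definition diag_mat :: "('n \<Rightarrow> real) \<Rightarrow> real^'n^'n" where
  "diag_mat d = (\<chi> i j. if i = j then d i else 0)"

lemma char_poly_diag_mat: "char_poly (diag_mat d) = (\<Prod>i\<in>UNIV. [:- d i, 1:])"
  unfolding char_poly_def by (subst det_diagonal) (auto simp: diag_mat_def intro!: prod.cong)

lemma diag_mat_mult: "diag_mat d ** diag_mat e = diag_mat (\<lambda>i. d i * e i)"
  by (auto simp: diag_mat_def matrix_matrix_mult_def vec_eq_iff if_distrib[of "\<lambda>x. x * _"] cong: if_cong)

lemma transpose_diag_mat: "transpose (diag_mat d) = diag_mat d"
  by (auto simp: diag_mat_def transpose_def vec_eq_iff)

section \<open>The spectral theorem\<close>

text \<open>
  The quadratic form has its minimum over \<open>W\<close> at \<open>x\<close>, so its derivative at \<open>x\<close> in the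
  direction \<open>w\<close>, which is \<open>2 * (w \<bullet> (K *v x))\<close>, vanishes.
\<close>

lemma psd_isotropic_orthogonal:
  fixes K :: "real^'n^'n"
  assumes K: "transpose K = K" and W: "subspace W" and psd: "\<And>w. w \<in> W \<Longrightarrow> 0 \<le> w \<bullet> (K *v w)"
    and x: "x \<in> W" "x \<bullet> (K *v x) = 0" and w: "w \<in> W"
  shows "w \<bullet> (K *v x) = 0"
proof (rule ccontr)
  define c where "c = w \<bullet> (K *v x)"
  define d where "d = w \<bullet> (K *v w)"
  assume "w \<bullet> (K *v x) \<noteq> 0"
  then have c: "c \<noteq> 0" by (simp add: c_def)
  have d: "0 \<le> d" by (simp add: d_def psd w)
  have "0 \<le> (x + t *\<^sub>R w) \<bullet> (K *v (x + t *\<^sub>R w))" for t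
    by (intro psd subspace_add subspace_scale W x w)
  moreover have "x \<bullet> (K *v w) = c"
    unfolding c_def by (metis K inner_commute inner_matrix_vector_mult)
  ultimately have q: "0 \<le> 2 * t * c + t\<^sup>2 * d" for t
    using x(2) by (simp add: algebra_simps matrix_vector_mult_scaleR c_def d_def power2_eq_square)
  \<comment> \<open>At \<open>t = - c / (d + 1)\<close> the linear term outweighs the quadratic one, also when \<open>d = 0\<close>.\<close>
  have "0 \<le> 2 * (- c / (d + 1)) * c + (- c / (d + 1))\<^sup>2 * d" by (rule q)
  also have "\<dots> = - (c\<^sup>2 * (d + 2)) / (d + 1)\<^sup>2"
    using d by (simp add: divide_simps power2_eq_square) (simp add: algebra_simps)
  also have "\<dots> < 0"
    using c d by (simp add: divide_neg_pos)
  finally show False by simp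
qed

text \<open>
  The form \<open>x \<bullet> (K *v x)\<close> attains a minimum \<open>l\<close> on the compact unit sphere of \<open>W\<close>. Then
  \<open>K - l I\<close> is positive semidefinite on \<open>W\<close> and isotropic at the minimizer \<open>x\<close>, so
  \<open>K *v x - l *\<^sub>R x\<close> is orthogonal to \<open>W\<close>; as it lies in \<open>W\<close>, it is zero.
\<close>

lemma eigenvector_in_invariant_subspace:
  fixes K :: "real^'n^'n"
  assumes K: "transpose K = K" and W: "subspace W" "dim W > 0" and inv: "\<And>w. w \<in> W \<Longrightarrow> K *v w \<in> W"
  obtains x l where "x \<in> W" "norm x = 1" "K *v x = l *\<^sub>R x"
proof -
  let ?C = "W \<inter> sphere 0 1"
  have "compact ?C"
    by (metis W(1) closed_Int_compact closed_subspace compact_sphere)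
  moreover obtain y where y: "y \<in> W" "y \<noteq> 0"
    using W(2) by (metis dim_eq_0 less_numeral_extra(3) subsetI singletonI)
  then have "y /\<^sub>R norm y \<in> ?C"
    using W(1) by (simp add: subspace_scale)
  then have "?C \<noteq> {}" by blast
  moreover have "continuous_on ?C (\<lambda>x. x \<bullet> (K *v x))"
    by (intro continuous_intros matrix_vector_mult_linear_continuous_on)
  ultimately obtain x where x: "x \<in> ?C" and xmin: "\<And>z. z \<in> ?C \<Longrightarrow> x \<bullet> (K *v x) \<le> z \<bullet> (K *v z)"
    using continuous_attains_inf by meson
  define l where "l = x \<bullet> (K *v x)"
  define T where "T = K - l *\<^sub>R mat 1"
  have Tv: "T *v z = K *v z - l *\<^sub>R z" for z
    by (simp add: T_def matrix_vector_mult_diff_rdistrib scaleR_matrix_vector_assoc[symmetric])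
  have psd: "0 \<le> z \<bullet> (T *v z)" if "z \<in> W" for z
  proof (cases "z = 0")
    case False
    then have "z /\<^sub>R norm z \<in> ?C" using that W(1) by (simp add: subspace_scale)
    from xmin[OF this] have "l \<le> (z \<bullet> (K *v z)) / (norm z)\<^sup>2"
      by (simp add: l_def matrix_vector_mult_scaleR power2_eq_square divide_simps)
    then have "l * (norm z)\<^sup>2 \<le> z \<bullet> (K *v z)"
      using False by (simp add: pos_le_divide_eq)
    then show ?thesis
      by (simp add: Tv inner_diff_right power2_norm_eq_inner)
  qed simp
  have "transpose T = T"
    using K by (simp add: T_def transpose_def vec_eq_iff mat_def)
  moreover have "x \<bullet> (T *v x) = 0"
    using x by (simp add: Tv inner_diff_right l_def norm_eq_1)
  moreover have "T *v x \<in> W"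
    using x inv W(1) by (simp add: Tv subspace_diff subspace_scale)
  ultimately have "(T *v x) \<bullet> (T *v x) = 0"
    using psd_isotropic_orthogonal[of T W x "T *v x"] W(1) psd x by blast
  then have "K *v x = l *\<^sub>R x" by (simp add: Tv)
  with x show ?thesis by (auto intro: that)
qed

text \<open>
  The spectral theorem for the restriction of \<open>K\<close> to an invariant subspace, by induction on the
  dimension: the orthogonal complement in \<open>W\<close> of an eigenvector is again invariant.
\<close>

lemma orthonormal_eigenbasis_of_invariant_subspace:
  fixes K :: "real^'n^'n"
  assumes K: "transpose K = K"
  shows "subspace W \<Longrightarrow> (\<And>w. w \<in> W \<Longrightarrow> K *v w \<in> W) \<Longrightarrow>
    \<exists>B l. B \<subseteq> W \<and> pairwise orthogonal B \<and> (\<forall>b\<in>B. norm b = 1 \<and> K *v b = l b *\<^sub>R b)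
       \<and> span B = W"
proof (induction "dim W" arbitrary: W rule: less_induct)
  case less
  show ?case
  proof (cases "dim W = 0")
    case True
    then have "W = {0}"
      using less.prems(1) by (metis dim_eq_0 subset_singletonD subspace_0 empty_iff)
    then show ?thesis by (intro exI[of _ "{}"]) simp
  next
    case False
    then obtain x m where x: "x \<in> W" "norm x = 1" "K *v x = m *\<^sub>R x"
      using eigenvector_in_invariant_subspace[OF K less.prems(1) _ less.prems(2)] by blast
    define V where "V = {y \<in> W. orthogonal x y}"
    have V: "subspace V"
      unfolding V_def using less.prems(1) by (auto simp: subspace_def orthogonal_clauses)
    have "x \<notin> V" using x by (auto simp: V_def orthogonal_def)
    then have "V \<subset> W" using x by (auto simp: V_def)
    then have "dim V < dim W"
      using V less.prems(1) by (metis dim_psubset span_eq_iff)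
    moreover have "K *v y \<in> V" if "y \<in> V" for y
    proof -
      have "x \<bullet> (K *v y) = (K *v x) \<bullet> y"
        by (simp add: K inner_matrix_vector_mult del: transpose_matrix_vector)
      then show ?thesis
        using that x less.prems(2) by (simp add: V_def orthogonal_def)
    qed
    ultimately obtain B l where B: "B \<subseteq> V" "pairwise orthogonal B"
      "\<forall>b\<in>B. norm b = 1 \<and> K *v b = l b *\<^sub>R b" "span B = V"
      using less.hyps[OF _ V] by blast
    have "span (insert x B) = W"
    proof
      show "span (insert x B) \<subseteq> W"
        using B x less.prems(1) by (intro span_minimal) (auto simp: V_def)
      show "W \<subseteq> span (insert x B)"
      proof
        fix w assume w: "w \<in> W"
        have "w - (x \<bullet> w) *\<^sub>R x \<in> V"
          using w x less.prems(1)
          by (auto simp: V_def subspace_diff subspace_scale orthogonal_def inner_diff_right norm_eq_1)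
        then show "w \<in> span (insert x B)"
          using B(4) span_breakdown_eq by blast
      qed
    qed
    moreover have "pairwise orthogonal (insert x B)"
      using B by (auto simp: pairwise_insert V_def orthogonal_commute)
    ultimately show ?thesis
      using B x \<open>x \<notin> V\<close>
      by (intro exI[of _ "insert x B"] exI[of _ "l(x := m)"]) (auto simp: V_def)
  qed
qed

lemma card_orthonormal:
  fixes B :: "'a::euclidean_space set"
  assumes "pairwise orthogonal B" and "\<And>b. b \<in> B \<Longrightarrow> norm b = 1"
  shows "finite B" and "card B = dim (span B)"
proof -
  have "independent B"
    by (rule pairwise_orthogonal_independent[OF assms(1)]) (use assms(2) in force)
  then show "finite B" "card B = dim (span B)"
    by (simp_all add: independent_imp_finite dim_eq_card_independent)
qed

text \<open>
  The columns of \<open>U\<close> are the vectors of \<open>B\<close>, numbered by \<open>f\<close>. The bijection is kept in the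
  conclusion because the characteristic polynomial is to be written as a product over \<open>B\<close>.
\<close>

lemma orthonormal_eigenbasis_diagonalizes:
  fixes K :: "real^'n^'n"
  assumes "pairwise orthogonal B" and b1: "\<And>b. b \<in> B \<Longrightarrow> norm b = 1"
    and card: "card B = CARD('n)" and eig: "\<And>b. b \<in> B \<Longrightarrow> K *v b = l b *\<^sub>R b"
  obtains U f where "bij_betw f UNIV B" "orthogonal_matrix U"
    "K = U ** diag_mat (l \<circ> f) ** transpose U"
proof -
  have "finite B" using card_orthonormal assms(1) b1 by blast
  then obtain f :: "'n \<Rightarrow> real^'n" where f: "bij_betw f UNIV B"
    using card by (metis finite_class.finite_UNIV finite_same_card_bij)
  define U :: "real^'n^'n" where "U = (\<chi> i j. f j $ i)"
  have col: "column j U = f j" for j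
    by (simp add: U_def column_def vec_eq_iff)
  have fB: "f j \<in> B" for j using f by (auto simp: bij_betw_def)
  have "orthogonal_matrix U"
    unfolding orthogonal_matrix_orthonormal_columns col
    using assms(1) b1 fB f unfolding pairwise_def bij_betw_def inj_on_def by (metis UNIV_I)
  moreover have "K ** U = U ** diag_mat (l \<circ> f)"
  proof -
    have "(K ** U) $ i $ j = (K *v column j U) $ i" for i j
      by (simp add: matrix_matrix_mult_def matrix_vector_mult_def column_def)
    also have "(K *v column j U) $ i = l (f j) * f j $ i" for i j
      by (simp add: col eig fB)
    also have "l (f j) * f j $ i = (U ** diag_mat (l \<circ> f)) $ i $ j" for i j
      by (simp add: matrix_matrix_mult_def diag_mat_def U_def if_distrib[of "\<lambda>x. _ * x"] cong: if_cong)
    finally show ?thesis by (simp add: vec_eq_iff)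
  qed
  then have "K = U ** diag_mat (l \<circ> f) ** transpose U"
    using \<open>orthogonal_matrix U\<close> unfolding orthogonal_matrix_def
    by (metis matrix_mul_assoc matrix_mul_rid)
  ultimately show ?thesis using f that by blast
qed

lemma symmetric_matrix_diagonalizable:
  fixes K :: "real^'n^'n"
  assumes "transpose K = K"
  obtains U d where "orthogonal_matrix U" "K = U ** diag_mat d ** transpose U"
proof -
  obtain B l where B: "pairwise orthogonal B" "\<forall>b\<in>B. norm b = 1 \<and> K *v b = l b *\<^sub>R b" "span B = UNIV"
    using orthonormal_eigenbasis_of_invariant_subspace[OF assms, of UNIV] by auto
  then have "card B = CARD('n)"
    using card_orthonormal[of B] by simp
  then show ?thesis
    using orthonormal_eigenbasis_diagonalizes[of B K l] B that by metis
qed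

lemma char_poly_orthonormal_eigenbasis:
  fixes K :: "real^'n^'n"
  assumes "pairwise orthogonal B" and "\<And>b. b \<in> B \<Longrightarrow> norm b = 1"
    and "card B = CARD('n)" and "\<And>b. b \<in> B \<Longrightarrow> K *v b = l b *\<^sub>R b"
  shows "char_poly K = (\<Prod>b\<in>B. [:- l b, 1:])"
proof -
  obtain U f where f: "bij_betw f UNIV B" and U: "orthogonal_matrix U"
    and K: "K = U ** diag_mat (l \<circ> f) ** transpose U"
    using orthonormal_eigenbasis_diagonalizes[OF assms] by blast
  have "char_poly K = char_poly (transpose U ** (U ** diag_mat (l \<circ> f)))"
    unfolding K by (rule char_poly_mult_commute)
  also have "transpose U ** (U ** diag_mat (l \<circ> f)) = diag_mat (l \<circ> f)"
    using U by (simp add: matrix_mul_assoc orthogonal_matrix)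
  also have "char_poly \<dots> = (\<Prod>b\<in>B. [:- l b, 1:])"
    unfolding char_poly_diag_mat using prod.reindex_bij_betw[OF f, of "\<lambda>b. [:- l b, 1:]"] by simp
  finally show ?thesis .
qed

section \<open>Square roots and pseudoinverses\<close>

lemma symmetric_square_root_exists:
  fixes A :: "real^'n^'n"
  assumes "sym_psd A"
  obtains S where "transpose S = S" "S ** S = A"
proof -
  have A: "transpose A = A" and psd: "\<And>v. 0 \<le> v \<bullet> (A *v v)"
    using assms by (auto simp: sym_psd_def)
  obtain U d where U: "orthogonal_matrix U" and Ad: "A = U ** diag_mat d ** transpose U"
    using symmetric_matrix_diagonalizable[OF A] .
  have d: "0 \<le> d i" for i
  proof -
    \<comment> \<open>\<open>d i\<close> is the value of the quadratic form at the \<open>i\<close>-th column of \<open>U\<close>.\<close>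
    have "0 \<le> (column i U) \<bullet> (A *v column i U)" by (rule psd)
    also have "column i U = U *v axis i 1"
      by (simp add: matrix_vector_mult_basis)
    also have "(U *v axis i 1) \<bullet> (A *v (U *v axis i 1)) =
        axis i 1 \<bullet> ((transpose U ** U ** diag_mat d ** (transpose U ** U)) *v axis i 1)"
      by (simp add: inner_matrix_vector_mult Ad matrix_vector_mul_assoc matrix_mul_assoc
          del: transpose_matrix_vector)
    also have "\<dots> = axis i 1 \<bullet> column i (diag_mat d)"
      using U by (simp add: orthogonal_matrix matrix_vector_mult_basis)
    also have "\<dots> = d i"
      by (simp add: inner_axis' column_def diag_mat_def)
    finally show ?thesis .
  qed
  define S where "S = U ** diag_mat (\<lambda>i. sqrt (d i)) ** transpose U"
  have "S ** S = U ** diag_mat (\<lambda>i. sqrt (d i)) ** (transpose U ** U) ** diag_mat (\<lambda>i. sqrt (d i)) ** transpose U"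
    by (simp add: S_def matrix_mul_assoc)
  also have "\<dots> = U ** (diag_mat (\<lambda>i. sqrt (d i)) ** diag_mat (\<lambda>i. sqrt (d i))) ** transpose U"
    using U by (simp add: orthogonal_matrix matrix_mul_assoc)
  also have "\<dots> = A"
    using d by (simp add: diag_mat_mult Ad)
  finally have "S ** S = A" .
  moreover have "transpose S = S"
    by (simp add: S_def matrix_transpose_mul transpose_diag_mat matrix_mul_assoc)
  ultimately show ?thesis using that by blast
qed

text \<open>
  By symmetry of the four products, \<open>A ** X = A ** Y\<close> and \<open>X ** A = Y ** A\<close>, whence
  \<open>X = X ** A ** X = Y ** A ** Y = Y\<close>.
\<close>

lemma is_pinv_unique:
  assumes "is_pinv A X" "is_pinv A Y"
  shows "X = Y"
proof -
  have *: "A ** X ** A = A" "X ** A ** X = X" "transpose (A ** X) = A ** X" "transpose (X ** A) = X ** A"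
    "A ** Y ** A = A" "Y ** A ** Y = Y" "transpose (A ** Y) = A ** Y" "transpose (Y ** A) = Y ** A"
    using assms by (auto simp: is_pinv_def)
  have "A ** X = transpose (A ** Y ** (A ** X))"
    using * by (metis matrix_mul_assoc)
  also have "\<dots> = A ** X ** (A ** Y)"
    by (simp add: matrix_transpose_mul[of "A ** Y"] *)
  finally have 1: "A ** X = A ** Y"
    using * by (metis matrix_mul_assoc)
  have "X ** A = transpose (X ** A ** (Y ** A))"
    using * by (metis matrix_mul_assoc)
  also have "\<dots> = Y ** A ** (X ** A)"
    by (simp add: matrix_transpose_mul[of "X ** A"] *)
  finally have 2: "X ** A = Y ** A"
    using * by (metis matrix_mul_assoc)
  show ?thesis
    using * 1 2 by (metis matrix_mul_assoc)
qed

lemma is_pinv_transpose: "is_pinv A X \<Longrightarrow> is_pinv (transpose A) (transpose X)"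
  unfolding is_pinv_def by (metis matrix_transpose_mul matrix_mul_assoc)

text \<open>
  For symmetric \<open>C\<close> the pseudoinverse is obtained by inverting the nonzero eigenvalues in an
  orthogonal diagonalization; \<open>inverse 0 = 0\<close> does the right thing for the others.
\<close>

lemma pinv_symmetric:
  fixes C :: "real^'n^'n"
  assumes "transpose C = C"
  shows "is_pinv C (pinv C)" and "transpose (pinv C) = pinv C"
proof -
  obtain U d where U: "orthogonal_matrix U" and C: "C = U ** diag_mat d ** transpose U"
    using symmetric_matrix_diagonalizable[OF assms] .
  define F where "F e = U ** diag_mat e ** transpose U" for e
  have mult: "F e ** F g = F (\<lambda>i. e i * g i)" for e g
  proof -
    have "F e ** F g = U ** diag_mat e ** (transpose U ** U) ** diag_mat g ** transpose U"
      by (simp add: F_def matrix_mul_assoc)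
    also have "\<dots> = U ** (diag_mat e ** diag_mat g) ** transpose U"
      using U by (simp add: orthogonal_matrix matrix_mul_assoc)
    finally show ?thesis by (simp add: diag_mat_mult F_def)
  qed
  have F_sym: "transpose (F e) = F e" for e
    by (simp add: F_def matrix_transpose_mul transpose_diag_mat matrix_mul_assoc)
  have inv: "d i * inverse (d i) * d i = d i" "inverse (d i) * d i * inverse (d i) = inverse (d i)" for i
    by (cases "d i = 0"; simp)+
  have "is_pinv (F d) (F (\<lambda>i. inverse (d i)))"
    unfolding is_pinv_def mult inv F_sym by simp
  then have "is_pinv C (F (\<lambda>i. inverse (d i)))"
    by (simp add: C F_def)
  then show 1: "is_pinv C (pinv C)"
    unfolding pinv_def by (metis is_pinv_unique theI)
  show "transpose (pinv C) = pinv C"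
    using is_pinv_unique[OF is_pinv_transpose[OF 1, unfolded assms] 1] .
qed

section \<open>Gram matrices\<close>

lemma gram_null:
  fixes G :: "real^'c^'n"
  assumes "transpose G *v (G *v x) = 0"
  shows "G *v x = 0"
proof -
  have "(G *v x) \<bullet> (G *v x) = x \<bullet> (transpose G *v (G *v x))"
    by (rule inner_matrix_vector_mult)
  then show ?thesis by (simp add: assms del: transpose_matrix_vector)
qed

text \<open>
  On the range of \<open>G\<close> the map \<open>transpose G\<close> is injective, because \<open>G\<close> and its Gram matrix
  have the same null space.
\<close>

lemma rank_gram:
  fixes G :: "real^'c^'n"
  shows "rank (transpose G ** G) = rank G"
proof -
  let ?R = "range (\<lambda>x. G *v x)"
  have R: "subspace ?R"
    by (simp add: linear_subspace_image)
  have "range (\<lambda>x. (transpose G ** G) *v x) = (*v) (transpose G) ` ?R"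
    by (simp add: image_image matrix_vector_mul_assoc del: transpose_matrix_vector)
  moreover have "inj_on ((*v) (transpose G)) (span ?R)"
  proof (rule inj_onI)
    fix y z assume "y \<in> span ?R" "z \<in> span ?R" and eq: "transpose G *v y = transpose G *v z"
    moreover have "span ?R = ?R"
      using R by (simp only: span_eq_iff)
    ultimately obtain a b where "y = G *v a" "z = G *v b"
      by (metis imageE)
    then have "G *v (a - b) = 0"
      using eq \<open>y = _\<close> \<open>z = _\<close> by - (rule gram_null, simp add: matrix_vector_mult_diff_distrib del: transpose_matrix_vector)
    then show "y = z" using \<open>y = _\<close> \<open>z = _\<close> by (simp add: matrix_vector_mult_diff_distrib)
  qed
  ultimately show ?thesis
    unfolding rank_dim_range using dim_image_eq[OF matrix_vector_mul_linear] by metis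
qed

text \<open>
  \<open>Q\<close> is the orthogonal projector onto the range of \<open>G\<close>. The last identity holds because
  the range of \<open>Z ** (transpose G ** G) - mat 1\<close>, with \<open>Z\<close> the pseudoinverse, is annihilated by
  the Gram matrix and hence by \<open>G\<close>.
\<close>

lemma gram_pinv_projector:
  fixes G :: "real^'c^'n"
  defines "Q \<equiv> G ** pinv (transpose G ** G) ** transpose G"
  shows "transpose Q = Q" and "Q ** Q = Q" and "Q ** G = G"
proof -
  define Z where "Z = pinv (transpose G ** G)"
  have "transpose (transpose G ** G) = transpose G ** G"
    by (simp add: matrix_transpose_mul)
  from pinv_symmetric[OF this] have Z: "is_pinv (transpose G ** G) Z" and Zt: "transpose Z = Z"
    by (simp_all add: Z_def)
  have Q: "Q = G ** Z ** transpose G" by (simp add: Q_def Z_def)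
  show "transpose Q = Q"
    by (simp add: Q matrix_transpose_mul Zt matrix_mul_assoc)
  have "Q ** Q = G ** (Z ** (transpose G ** G) ** Z) ** transpose G"
    by (simp add: Q matrix_mul_assoc)
  then show "Q ** Q = Q"
    using Z by (simp add: Q is_pinv_def)
  show "Q ** G = G"
  proof (simp add: matrix_eq, rule allI)
    fix x
    let ?y = "(Z ** (transpose G ** G)) *v x - x"
    have "transpose G *v (G *v ?y) = (transpose G ** G ** Z ** (transpose G ** G)) *v x - (transpose G ** G) *v x"
      by (simp add: matrix_vector_mult_diff_distrib matrix_vector_mul_assoc matrix_mul_assoc del: transpose_matrix_vector)
    also have "\<dots> = 0" using Z by (simp add: is_pinv_def)
    finally have "G *v ?y = 0" by (rule gram_null)
    then show "(Q ** G) *v x = G *v x"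
      by (simp add: Q matrix_vector_mult_diff_distrib matrix_vector_mul_assoc matrix_mul_assoc)
  qed
qed

section \<open>Ordered eigenvalues and Rayleigh quotients\<close>

text \<open>
  As \<open>K\<close> is symmetric with range in \<open>W\<close>, it vanishes on the orthogonal complement of \<open>W\<close>,
  which contributes \<open>CARD('n) - dim W\<close> zero eigenvalues. The other eigenvalues belong to
  eigenvectors in \<open>W\<close> and are nonnegative, so in the sorted list they follow these zeros, and
  the first of them is the minimum of the Rayleigh quotient of \<open>K\<close> over \<open>W\<close>.
\<close>

lemma nth_smallest_eigenvalue_compression:
  fixes K :: "real^'n^'n"
  assumes K: "transpose K = K" and W: "subspace W" "dim W > 0" and range: "\<And>x. K *v x \<in> W"
    and psd: "\<And>w. w \<in> W \<Longrightarrow> 0 \<le> w \<bullet> (K *v w)"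
  defines "\<mu> \<equiv> nth_smallest_eigenvalue (CARD('n) - dim W + 1) K"
  shows "\<exists>w\<in>W. norm w = 1 \<and> K *v w = \<mu> *\<^sub>R w"
    and "\<And>w. w \<in> W \<Longrightarrow> \<mu> * (norm w)\<^sup>2 \<le> w \<bullet> (K *v w)"
proof -
  obtain B l where B: "B \<subseteq> W" "pairwise orthogonal B" and Bl: "\<forall>b\<in>B. norm b = 1 \<and> K *v b = l b *\<^sub>R b"
    and span: "span B = W"
    using orthonormal_eigenbasis_of_invariant_subspace[OF K W(1) range] by (elim exE conjE) blast
  have fin: "finite B" and cardB: "card B = dim W"
    using card_orthonormal[OF B(2)] Bl span by auto
  define V where "V = {y. \<forall>x\<in>W. orthogonal x y}"
  have V: "subspace V" unfolding V_def by (rule subspace_orthogonal_to_vectors)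
  obtain C where C: "C \<subseteq> V" "pairwise orthogonal C" "\<And>x. x \<in> C \<Longrightarrow> norm x = 1" "independent C" "card C = dim V"
    using orthonormal_basis_subspace[OF V] by metis
  have dimV: "dim V + dim W = CARD('n)"
    using dim_subspace_orthogonal_to_vectors[OF W(1) subspace_UNIV] by (simp add: V_def)
  have finC: "finite C" using C(4) independent_imp_finite by blast
  have orth: "orthogonal b c" if "b \<in> B" "c \<in> C" for b c
    using that B(1) C(1) by (auto simp: V_def)
  have disj: "B \<inter> C = {}"
    using orth Bl by (fastforce simp: orthogonal_def)
  have KC: "K *v c = 0" if "c \<in> C" for c
  proof -
    have "(K *v c) \<bullet> (K *v c) = c \<bullet> (K *v (K *v c))"
      using inner_matrix_vector_mult[of K c "K *v c"] K by simp
    also have "\<dots> = 0"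
      using that C(1) range by (auto simp: V_def orthogonal_def inner_commute)
    finally show ?thesis by simp
  qed
  \<comment> \<open>The eigenvalue function on the eigenbasis \<open>B \<union> C\<close> of the whole space.\<close>
  define m where "m b = (if b \<in> B then l b else 0)" for b
  have "pairwise orthogonal (B \<union> C)"
    using B(2) C(2) orth unfolding pairwise_def by (metis Un_iff orthogonal_commute)
  moreover have "card (B \<union> C) = CARD('n)"
    using dimV cardB C(5) fin finC disj by (simp add: card_Un_disjoint)
  ultimately have "char_poly K = (\<Prod>b\<in>B \<union> C. [:- m b, 1:])"
    using Bl KC C(3) by (intro char_poly_orthonormal_eigenbasis) (auto simp: m_def)
  then have "proots (char_poly K) = (\<Sum>b\<in>B \<union> C. {#m b#})"
    by (simp add: proots_prod)
  also have "\<dots> = (\<Sum>b\<in>C. {#0#}) + (\<Sum>b\<in>B. {#l b#})"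
    using fin finC disj
    by (subst sum.union_disjoint) (auto simp: m_def add.commute intro!: arg_cong2[where f="(+)"] sum.cong)
  also have "(\<Sum>b\<in>C. {#0#}) = replicate_mset (dim V) (0::real)"
    using finC unfolding C(5)[symmetric] by (induction C rule: finite_induct) auto
  also have "(\<Sum>b\<in>B. {#l b#}) = image_mset l (mset_set B)"
    using fin by (induction B rule: finite_induct) auto
  finally have roots: "proots (char_poly K) = replicate_mset (dim V) 0 + image_mset l (mset_set B)" .
  have l0: "0 \<le> l b" if "b \<in> B" for b
  proof -
    have "b \<bullet> (K *v b) = l b" using Bl that by (simp add: norm_eq_1)
    then show ?thesis using psd that B(1) by force
  qed
  define ys where "ys = sorted_list_of_multiset (image_mset l (mset_set B))"
  have set_ys: "set ys = l ` B" using fin by (simp add: ys_def)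
  have sorted: "sorted ys" by (simp add: ys_def)
  have "mset (replicate (dim V) 0 @ ys) = proots (char_poly K)"
    by (simp add: roots ys_def)
  then have "sorted_list_of_multiset (proots (char_poly K)) = sort (replicate (dim V) 0 @ ys)"
    by (metis sorted_list_of_multiset_mset)
  also have "\<dots> = replicate (dim V) 0 @ ys"
    using sorted set_ys l0 by (intro sort_key_id_if_sorted) (auto simp: sorted_append)
  finally have "sorted_list_of_multiset (proots (char_poly K)) ! dim V = ys ! 0"
    by (simp add: nth_append)
  then have mu: "\<mu> = ys ! 0"
    using dimV by (simp add: \<mu>_def nth_smallest_eigenvalue_def flip: dimV)
  have "B \<noteq> {}" using cardB W(2) by (metis card.empty less_irrefl)
  then have "ys \<noteq> []" using set_ys by auto
  then have "\<mu> \<in> l ` B"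
    using mu set_ys by (metis length_greater_0_conv nth_mem)
  then show "\<exists>w\<in>W. norm w = 1 \<and> K *v w = \<mu> *\<^sub>R w"
    using B(1) Bl by auto
  have min: "\<mu> \<le> l b" if "b \<in> B" for b
    using that sorted mu set_ys by (metis imageI in_set_conv_nth le0 sorted_nth_mono)
  fix w assume "w \<in> W"
  then have w: "(\<Sum>b\<in>B. (w \<bullet> b) *\<^sub>R b) = w"
    using orthonormal_basis_expand[OF B(2)] Bl span fin by blast
  \<comment> \<open>Expand \<open>w\<close> in the eigenbasis of \<open>W\<close> and bound each eigenvalue from below.\<close>
  have "\<mu> * (norm w)\<^sup>2 = \<mu> * (w \<bullet> (\<Sum>b\<in>B. (w \<bullet> b) *\<^sub>R b))"
    by (simp add: w power2_norm_eq_inner)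
  also have "\<dots> = (\<Sum>b\<in>B. \<mu> * (w \<bullet> b)\<^sup>2)"
    by (simp add: inner_sum_right sum_distrib_left power2_eq_square)
  also have "\<dots> \<le> (\<Sum>b\<in>B. l b * (w \<bullet> b)\<^sup>2)"
    by (intro sum_mono mult_right_mono min) auto
  also have "\<dots> = w \<bullet> (\<Sum>b\<in>B. (w \<bullet> b) *\<^sub>R (l b *\<^sub>R b))"
    by (simp add: inner_sum_right power2_eq_square mult_ac)
  also have "(\<Sum>b\<in>B. (w \<bullet> b) *\<^sub>R (l b *\<^sub>R b)) = K *v (\<Sum>b\<in>B. (w \<bullet> b) *\<^sub>R b)"
    using Bl by (simp add: linear_sum[OF matrix_vector_mul_linear] matrix_vector_mult_scaleR cong: sum.cong)
  finally show "\<mu> * (norm w)\<^sup>2 \<le> w \<bullet> (K *v w)" by (simp add: w)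
qed

section \<open>The energy seminorm\<close>

text \<open>
  A symmetric square root turns the energy seminorm into the Euclidean norm, so that the
  operator seminorm becomes a supremum of quotients of Euclidean norms.
\<close>

lemma norm_wrt_eq_norm_sqrt:
  fixes S :: "real^'n^'n"
  assumes "transpose S = S"
  shows "norm_wrt (S ** S) v = norm (S *v v)"
  using inner_matrix_vector_mult[of S v "S *v v"] assms
  by (simp add: norm_wrt_def norm_eq_sqrt_inner matrix_vector_mul_assoc)

lemma null_space_sqrt_square:
  fixes S :: "real^'n^'n"
  assumes "transpose S = S"
  shows "null_space (S ** S) = null_space S"
  using gram_null[of S] assms by (auto simp: null_space_def matrix_vector_mul_assoc[symmetric])

lemma mnorm_wrt_eqI:
  fixes S :: "real^'n^'n"
  assumes S: "transpose S = S" and le: "\<And>v. norm (S *v (X *v v)) \<le> c * norm (S *v v)"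
    and v: "S *v v \<noteq> 0" "c * norm (S *v v) \<le> norm (S *v (X *v v))"
  shows "mnorm_wrt (S ** S) X = ereal c"
proof -
  have eq: "mnorm_wrt (S ** S) X = (SUP v\<in>- null_space S. ereal (norm (S *v (X *v v)) / norm (S *v v)))"
    by (simp add: mnorm_wrt_def norm_wrt_eq_norm_sqrt[OF S] null_space_sqrt_square[OF S])
  show ?thesis
    unfolding eq
  proof (rule antisym)
    show "(SUP v\<in>- null_space S. ereal (norm (S *v (X *v v)) / norm (S *v v))) \<le> ereal c"
      using le by (intro SUP_least) (simp add: null_space_def pos_divide_le_eq)
    show "ereal c \<le> (SUP v\<in>- null_space S. ereal (norm (S *v (X *v v)) / norm (S *v v)))"
      using v by (intro SUP_upper2[of v]) (auto simp: null_space_def pos_le_divide_eq)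
  qed
qed

lemma mnorm_wrt_le_1D:
  fixes S :: "real^'n^'n"
  assumes S: "transpose S = S" and le: "mnorm_wrt (S ** S) X \<le> 1" and v: "S *v v \<noteq> 0"
  shows "norm (S *v (X *v v)) \<le> norm (S *v v)"
proof -
  have "ereal (norm (S *v (X *v v)) / norm (S *v v)) \<le> mnorm_wrt (S ** S) X"
    unfolding mnorm_wrt_def norm_wrt_eq_norm_sqrt[OF S] null_space_sqrt_square[OF S]
    using v by (intro SUP_upper) (simp add: null_space_def)
  then have "ereal (norm (S *v (X *v v)) / norm (S *v v)) \<le> 1"
    using le by (rule order_trans)
  then show ?thesis
    using v by (simp add: pos_divide_le_eq)
qed

section \<open>The convergence factor\<close>

theorem theorem3p3:
  fixes A M :: "real^'n^'n"
    and P :: "real^'c^'n"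
    and r s :: nat
  assumes "A \<noteq> 0" and "sym_psd A"
    and "mnorm_wrt A (mat 1 - M ** A) \<le> 1"
    and "CARD('c) < CARD('n)"
    and "coarse_matrix A P \<noteq> 0"
    and "null_space (psd_sqrt A ** M_bar A M ** psd_sqrt A)
           \<inter> null_space (transpose P ** (mat 1 - A ** M) ** psd_sqrt A) = null_space A"
    and "r = rank A" and "s = rank (coarse_matrix A P)" and "s < r"
  shows "mnorm_wrt A (E_TG A M P) =
           ereal (sqrt (1 - nth_smallest_eigenvalue (CARD('n) - r + s + 1)
                              (M_tilde A M ** A ** (mat 1 - Pi_A A P))))"
proof -
  note [simp del] = transpose_matrix_vector
  obtain S where S: "transpose S = S" and SS: "S ** S = A"
    using symmetric_square_root_exists[OF assms(2)] .
  have S_move: "(S *v x) \<bullet> y = x \<bullet> (S *v y)" for x y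
    using inner_matrix_vector_mult[of S] S by simp
  have A_S: "A *v x = S *v (S *v x)" for x
    by (simp add: SS matrix_vector_mul_assoc)
  define G where "G = S ** P"
  have Ac: "coarse_matrix A P = transpose G ** G"
    by (simp add: coarse_matrix_def G_def matrix_transpose_mul S matrix_mul_assoc flip: SS)
  \<comment> \<open>In the coordinates given by \<open>S\<close> \<open>Pi_A A P\<close> becomes
      the orthogonal projector onto the range of \<open>S ** P\<close>.\<close>
  define Q where "Q = G ** pinv (transpose G ** G) ** transpose G"
  have Qt: "transpose Q = Q" and QQ: "Q ** Q = Q" and QG: "Q ** G = G"
    unfolding Q_def by (rule gram_pinv_projector)+
  have Q_move: "(Q *v x) \<bullet> y = x \<bullet> (Q *v y)" for x y
    using inner_matrix_vector_mult[of Q] Qt by simp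
  have Q_range: "Q *v x \<in> range ((*v) G)" for x
    by (auto simp: Q_def matrix_vector_mul_assoc[symmetric])
  have G_range: "range ((*v) G) \<subseteq> range ((*v) S)"
    by (auto simp: G_def matrix_vector_mul_assoc[symmetric])
  have subS: "subspace (range ((*v) S))" and subG: "subspace (range ((*v) G))"
    by (simp_all add: linear_subspace_image)
  have S_Pi: "S *v (v - Pi_A A P *v v) = S *v v - Q *v (S *v v)" for v
  proof -
    define Z where "Z = pinv (coarse_matrix A P)"
    have Pi: "Pi_A A P = P ** Z ** transpose P ** A" and Q: "Q = S ** P ** Z ** transpose P ** S"
      by (simp_all add: Pi_A_def Z_def Q_def Ac) (simp add: G_def matrix_transpose_mul S matrix_mul_assoc)
    have "S ** Pi_A A P = Q ** S"
      unfolding Pi Q by (simp add: matrix_mul_assoc flip: SS)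
    then show ?thesis
      by (simp add: matrix_vector_mult_diff_distrib matrix_vector_mul_assoc)
  qed

  \<comment> \<open>The part of the range of \<open>S\<close> that the coarse correction leaves untouched;
      all of the error after a coarse correction lives here.\<close>
  define W where "W = {y \<in> range ((*v) S). \<forall>x \<in> range ((*v) G). orthogonal x y}"
  have W: "subspace W"
    using subS by (auto simp: W_def subspace_def orthogonal_clauses)
  have "dim W + rank G = rank S"
    unfolding W_def rank_dim_range by (rule dim_subspace_orthogonal_to_vectors[OF subG subS G_range])
  moreover have "rank S = r"
    using rank_gram[of S] S SS assms(7) by simp
  moreover have "rank G = s"
    using rank_gram[of G] Ac assms(8) by simp
  ultimately have dimW: "dim W + s = r" by simp
  have "r \<le> CARD('n)" using rank_bound[of A] assms(7) by simp
  then have index: "CARD('n) - r + s + 1 = CARD('n) - dim W + 1"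
    using dimW by simp
  have WS: "w \<in> range ((*v) S)" if "w \<in> W" for w using that by (simp add: W_def)
  have QW: "Q *v w = 0" if "w \<in> W" for w
  proof -
    have "(Q *v w) \<bullet> (Q *v w) = (Q *v w) \<bullet> w"
      by (simp add: Q_move matrix_vector_mul_assoc QQ)
    also have "\<dots> = 0"
      using that Q_range[of w] unfolding W_def orthogonal_def by blast
    finally show ?thesis by simp
  qed
  have proj_W: "z - Q *v z \<in> W" if "z \<in> range ((*v) S)" for z
  proof -
    have "(G *v a) \<bullet> (z - Q *v z) = 0" for a
      by (simp add: inner_diff_right Q_move[symmetric]) (simp add: matrix_vector_mul_assoc QG)
    moreover have "z - Q *v z \<in> range ((*v) S)"
      using that Q_range G_range subS by (blast intro: subspace_diff)
    ultimately show ?thesis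
      by (auto simp: W_def orthogonal_def)
  qed

  \<comment> \<open>\<open>K\<close> is the compression of \<open>T\<close> to \<open>W\<close>; its two factors, interchanged,
      give the matrix of the theorem.\<close>
  define T where "T = S ** M_tilde A M ** S"
  define K where "K = ((mat 1 - Q) ** S) ** (M_tilde A M ** S ** (mat 1 - Q))"
  have Kv: "K *v x = T *v (x - Q *v x) - Q *v (T *v (x - Q *v x))" for x
    by (simp add: K_def T_def matrix_vector_mul_assoc[symmetric] matrix_vector_mult_mat1_minus)
  have "transpose A = A" using assms(2) by (simp add: sym_psd_def)
  then have "transpose (M_tilde A M) = M_tilde A M"
    by (simp add: M_tilde_def transpose_add transpose_diff matrix_transpose_mul matrix_mul_assoc add.commute)
  then have K: "transpose K = K"
    by (simp add: K_def matrix_transpose_mul transpose_diff Qt S matrix_mul_assoc)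
  have range_K: "K *v x \<in> W" for x
    unfolding Kv by (rule proj_W) (simp add: T_def matrix_vector_mul_assoc[symmetric])
  have char_poly: "char_poly (M_tilde A M ** A ** (mat 1 - Pi_A A P)) = char_poly K"
  proof -
    have "M_tilde A M ** A ** (mat 1 - Pi_A A P) = (M_tilde A M ** S ** (mat 1 - Q)) ** ((mat 1 - Q) ** S)"
    proof (simp only: matrix_eq, rule allI)
      fix v
      have "(S *v v - Q *v (S *v v)) - Q *v (S *v v - Q *v (S *v v)) = S *v v - Q *v (S *v v)"
        by (simp add: matrix_vector_mult_diff_distrib matrix_vector_mul_assoc matrix_mul_assoc QQ)
      then show "(M_tilde A M ** A ** (mat 1 - Pi_A A P)) *v v
          = ((M_tilde A M ** S ** (mat 1 - Q)) ** ((mat 1 - Q) ** S)) *v v"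
        by (simp add: matrix_vector_mul_assoc[symmetric] matrix_vector_mult_mat1_minus A_S S_Pi)
    qed
    then show ?thesis
      unfolding K_def by (simp only: char_poly_mult_commute)
  qed

  \<comment> \<open>\<open>X\<close> is the smoother in the coordinates given by \<open>S\<close>, and \<open>Y\<close> is its adjoint.\<close>
  define X where "X z = z - S *v (M *v (S *v z))" for z
  define Y where "Y z = z - S *v (transpose M *v (S *v z))" for z
  have XY: "X z \<bullet> y = z \<bullet> Y y" for z y
    by (simp add: X_def Y_def inner_diff_left inner_diff_right S inner_matrix_vector_mult)
  \<comment> \<open>The reason is that \<open>X \<circ> Y\<close> is the identity minus \<open>T\<close>.\<close>
  have Y_sq: "(norm (Y w))\<^sup>2 = (norm w)\<^sup>2 - w \<bullet> (T *v w)" for w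
  proof -
    have "(norm (Y w))\<^sup>2 = w \<bullet> X (Y w)"
      by (metis XY inner_commute power2_norm_eq_inner)
    also have "X (Y w) = w - T *v w"
      by (simp add: X_def Y_def T_def M_tilde_def matrix_vector_mul_assoc[symmetric] A_S
          matrix_vector_mult_diff_distrib matrix_vector_mult_diff_rdistrib
          matrix_vector_mult_add_rdistrib matrix_vector_right_distrib)
    finally show ?thesis by (simp add: inner_diff_right power2_norm_eq_inner)
  qed
  have X_range: "X z \<in> range ((*v) S)" and Y_range: "Y z \<in> range ((*v) S)" if "z \<in> range ((*v) S)" for z
    using that subS by (auto simp: X_def Y_def intro: subspace_diff)
  have S_smoother: "S *v ((mat 1 - M ** A) *v v) = X (S *v v)" for v
    by (simp add: X_def matrix_vector_mult_mat1_minus matrix_vector_mult_diff_distrib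
        matrix_vector_mul_assoc[symmetric] A_S)
  have X_contr: "norm (X z) \<le> norm z" if "z \<in> range ((*v) S)" for z
  proof (cases "z = 0")
    case False
    then show ?thesis
      using that mnorm_wrt_le_1D[OF S, of "mat 1 - M ** A"] assms(3) SS by (auto simp: S_smoother)
  qed (simp add: X_def)
  \<comment> \<open>The adjoint of a contraction is a contraction, and by \<open>Y_sq\<close> this is positivity of \<open>T\<close>.\<close>
  have T_psd: "0 \<le> w \<bullet> (T *v w)" if "w \<in> range ((*v) S)" for w
  proof -
    have "(norm (Y w))\<^sup>2 = X (Y w) \<bullet> w"
      by (simp add: XY power2_norm_eq_inner)
    also have "\<dots> \<le> norm (X (Y w)) * norm w"
      by (rule norm_cauchy_schwarz)
    also have "\<dots> \<le> norm (Y w) * norm w"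
      using X_contr[OF Y_range[OF that]] by (simp add: mult_right_mono)
    finally have "norm (Y w) \<le> norm w"
      by (cases "norm (Y w) = 0") (auto simp: power2_eq_square)
    then have "(norm (Y w))\<^sup>2 \<le> (norm w)\<^sup>2" by (simp add: power_mono)
    then show ?thesis by (simp add: Y_sq)
  qed
  have KW: "w \<bullet> (K *v w) = w \<bullet> (T *v w)" if "w \<in> W" for w
    using QW[OF that] by (simp add: Kv inner_diff_right Q_move[symmetric])

  define \<mu> where "\<mu> = nth_smallest_eigenvalue (CARD('n) - dim W + 1) K"
  have "\<exists>w\<in>W. norm w = 1 \<and> K *v w = \<mu> *\<^sub>R w"
    and min: "\<And>w. w \<in> W \<Longrightarrow> \<mu> * (norm w)\<^sup>2 \<le> w \<bullet> (K *v w)"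
    unfolding \<mu>_def using dimW assms(9) KW T_psd WS
    by (intro nth_smallest_eigenvalue_compression[OF K W _ range_K]; simp)+
  then obtain w where w: "w \<in> W" "norm w = 1" "K *v w = \<mu> *\<^sub>R w" by blast
  have Y_le: "norm (Y u) \<le> sqrt (1 - \<mu>) * norm u" if "u \<in> W" for u
  proof -
    have "(norm (Y u))\<^sup>2 \<le> (1 - \<mu>) * (norm u)\<^sup>2"
      using min[OF that] KW[OF that] by (simp add: Y_sq algebra_simps)
    then have "norm (Y u) \<le> sqrt ((1 - \<mu>) * (norm u)\<^sup>2)"
      by (rule real_le_rsqrt)
    then show ?thesis by (simp add: real_sqrt_mult)
  qed
  have Yw: "norm (Y w) = sqrt (1 - \<mu>)"
  proof -
    have "(norm (Y w))\<^sup>2 = 1 - \<mu>"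
      using KW[OF w(1)] w by (simp add: Y_sq flip: power2_norm_eq_inner)
    then show ?thesis by (metis norm_ge_zero real_sqrt_unique)
  qed
  have E: "S *v (E_TG A M P *v v) = X (S *v v) - Q *v X (S *v v)" for v
    by (simp add: E_TG_def flip: Pi_A_def S_smoother)
      (simp add: matrix_vector_mul_assoc[symmetric] matrix_vector_mult_mat1_minus S_Pi)
  \<comment> \<open>The error vector \<open>u\<close> after the coarse correction lies in \<open>W\<close>, so its norm
      is estimated by pairing it with itself and moving the smoother to the other side.\<close>
  have upper: "norm (S *v (E_TG A M P *v v)) \<le> sqrt (1 - \<mu>) * norm (S *v v)" for v
  proof -
    let ?z = "S *v v"
    let ?u = "X ?z - Q *v X ?z"
    have u: "?u \<in> W" by (simp add: proj_W X_range)
    have "?u \<bullet> ?u = X ?z \<bullet> ?u - X ?z \<bullet> (Q *v ?u)"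
      by (subst (1) inner_diff_left) (simp only: Q_move)
    then have "norm ?u * norm ?u = X ?z \<bullet> ?u"
      by (simp add: QW[OF u] flip: power2_norm_eq_inner power2_eq_square)
    also have "\<dots> \<le> norm ?z * norm (Y ?u)"
      unfolding XY by (rule norm_cauchy_schwarz)
    also have "\<dots> \<le> norm ?z * (sqrt (1 - \<mu>) * norm ?u)"
      by (intro mult_left_mono Y_le u) simp
    finally have "norm ?u \<le> sqrt (1 - \<mu>) * norm ?z"
      by (cases "norm ?u = 0") (auto simp: mult_ac Yw[symmetric])
    then show ?thesis by (simp add: E)
  qed
  \<comment> \<open>The bound is attained at \<open>Y w\<close>; if this vanishes, the bound is zero
      and any vector outside the null space will do.\<close>
  have "\<exists>v. S *v v \<noteq> 0 \<and> sqrt (1 - \<mu>) * norm (S *v v) \<le> norm (S *v (E_TG A M P *v v))"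
  proof (cases "Y w = 0")
    case True
    then have "sqrt (1 - \<mu>) = 0" using Yw by simp
    moreover obtain v where "S *v v \<noteq> 0"
      using w(1,2) WS by fastforce
    ultimately show ?thesis by (intro exI[of _ v]) simp
  next
    case False
    obtain v where v: "S *v v = Y w" using Y_range[OF WS[OF w(1)]] by auto
    have "norm (Y w) * norm (Y w) = w \<bullet> X (Y w)"
      by (metis XY inner_commute power2_norm_eq_inner power2_eq_square)
    also have "\<dots> = w \<bullet> (X (Y w) - Q *v X (Y w))"
      using QW[OF w(1)] by (simp add: inner_diff_right Q_move[symmetric])
    also have "\<dots> \<le> norm (X (Y w) - Q *v X (Y w))"
      using norm_cauchy_schwarz[of w] w(2) by simp
    finally show ?thesis
      using False v by (intro exI[of _ v]) (simp add: E Yw)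
  qed
  then obtain v where "S *v v \<noteq> 0" "sqrt (1 - \<mu>) * norm (S *v v) \<le> norm (S *v (E_TG A M P *v v))"
    by blast
  then have "mnorm_wrt A (E_TG A M P) = ereal (sqrt (1 - \<mu>))"
    using mnorm_wrt_eqI[OF S upper] SS by simp
  then show ?thesis
    unfolding \<mu>_def index nth_smallest_eigenvalue_def char_poly .
qed

end
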